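(* Let $\mathcal{E}:\mathrm{L}^2(X,m)\to[0,\infty]$ be a $2$-homogeneous, convex, lower semicontinuous functional. Then the following hold. 1. $\mathcal{E}(0)=0$. 2. The subdifferential $\partial\mathcal{E}$ is $1$-homogeneous, and the set $D(\partial\mathcal{E})$ is invariant under scalar multiplication. Conversely, if $\mathcal{E}:\mathrm{L}^2(X,m)\to[0,\infty]$ is a (nonnegative) convex, lower semicontinuous functional such that $\partial\mathcal{E}$ is $1$-homogeneous and $\mathcal{E}(0)=0$, then $\mathcal{E}$ is $2$-homogeneous. 3. For all $u\in D(\partial\mathcal{E})$ and all $\xi\in\partial\mathcal{E}(u)$, $$\int_X u\,\xi\,dm = 2\,\mathcal{E}(u).$$
   Context: $(X,\mathcal{F},m)$ is a $\sigma$-finite measure space such that $\mathcal{F}$ is in bi-measurable correspondence with the Borel class on $\mathbb{R}$; $\mathrm{L}^2(X,m)$ is the real Hilbert space of square-integrable functions. Lower semicontinuity is with respect to the $\mathrm{L}^2$-norm topology. A functional $\mathcal{E}:\mathrm{L}^2(X,m)\to[0,\infty]$ is $2$-homogeneous if $\mathcal{E}(\nu u)=\nu^2\mathcal{E}(u)$ for all $\nu\in\mathbb{R}$ and all $u\in\mathrm{L}^2(X,m)$ (with the convention $0\cdot\infty=0$). For a convex functional $\mathcal{E}$ and $u$ with $\mathcal{E}(u)<\infty$, the subdifferential is $\partial\mathcal{E}(u)=\{\xi\in\mathrm{L}^2(X,m): \mathcal{E}(z)-\mathcal{E}(u)\ge\int_X\xi\,(z-u)\,dm \text{ for all } z\in\mathrm{L}^2(X,m)\}$,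 and $\partial\mathcal{E}(u)=\emptyset$ if $\mathcal{E}(u)=\infty$. Its domain is $D(\partial\mathcal{E})=\{u:\partial\mathcal{E}(u)\neq\emptyset\}$. The subdifferential is $1$-homogeneous if $\partial\mathcal{E}(\nu u)=\nu\,\partial\mathcal{E}(u)$ for all $u\in\mathrm{L}^2(X,m)$ and all $\nu\in\mathbb{R}\setminus\{0\}$. *)

theory Defs
  imports "HOL-Analysis.Analysis"
begin

text \<open>
  Elements of \<open>L\<^sup>2(X,m)\<close> are represented by square-integrable real functions, without passing to
  the quotient by almost-everywhere equality. A functional on \<open>L\<^sup>2(X,m)\<close> is accordingly a
  function on representatives that is constant on almost-everywhere classes
  (\<open>L2_functional\<close>); its values off \<open>L2 M\<close> are irrelevant. Subdifferentials are
  then sets of representatives, closed under almost-everywhere equality.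
\<close>

definition bimeasurable_with_borel :: "'a measure \<Rightarrow> bool" where
  "bimeasurable_with_borel M \<longleftrightarrow>
     (\<exists>f :: 'a \<Rightarrow> real. bij_betw f (space M) UNIV \<and> f \<in> M \<rightarrow>\<^sub>M borel \<and>
        the_inv_into (space M) f \<in> borel \<rightarrow>\<^sub>M M)"

definition L2 :: "'a measure \<Rightarrow> ('a \<Rightarrow> real) set" where
  "L2 M = {u \<in> borel_measurable M. integrable M (\<lambda>x. (u x)\<^sup>2)}"

definition L2_norm :: "'a measure \<Rightarrow> ('a \<Rightarrow> real) \<Rightarrow> real" where
  "L2_norm M u = sqrt (LINT x|M. (u x)\<^sup>2)"

definition L2_functional :: "'a measure \<Rightarrow> (('a \<Rightarrow> real) \<Rightarrow> ennreal) \<Rightarrow> bool" where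
  "L2_functional M E \<longleftrightarrow>
     (\<forall>u\<in>L2 M. \<forall>v\<in>L2 M. (AE x in M. u x = v x) \<longrightarrow> E u = E v)"

definition L2_convex :: "'a measure \<Rightarrow> (('a \<Rightarrow> real) \<Rightarrow> ennreal) \<Rightarrow> bool" where
  "L2_convex M E \<longleftrightarrow>
     (\<forall>u\<in>L2 M. \<forall>v\<in>L2 M. \<forall>t\<in>{0..1}.
        E (\<lambda>x. t * u x + (1 - t) * v x) \<le> ennreal t * E u + ennreal (1 - t) * E v)"

definition L2_lsc :: "'a measure \<Rightarrow> (('a \<Rightarrow> real) \<Rightarrow> ennreal) \<Rightarrow> bool" where
  "L2_lsc M E \<longleftrightarrow>
     (\<forall>u\<in>L2 M. \<forall>c < E u. \<exists>\<delta>>0. \<forall>v\<in>L2 M. L2_norm M (\<lambda>x. v x - u x) < \<delta> \<longrightarrow> c < E v)"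

text \<open>The product in \<^typ>\<open>ennreal\<close> satisfies \<open>0 * \<infinity> = 0\<close>.\<close>

definition two_homogeneous :: "'a measure \<Rightarrow> (('a \<Rightarrow> real) \<Rightarrow> ennreal) \<Rightarrow> bool" where
  "two_homogeneous M E \<longleftrightarrow>
     (\<forall>u\<in>L2 M. \<forall>\<nu>::real. E (\<lambda>x. \<nu> * u x) = ennreal (\<nu>\<^sup>2) * E u)"

text \<open>
  The energies are compared in \<^typ>\<open>ereal\<close>, since subtraction on \<^typ>\<open>ennreal\<close> is truncated.
  As \<open>E u < \<infinity>\<close>, the difference is never of the form \<open>\<infinity> - \<infinity>\<close>.
\<close>

definition subdiff ::
  "'a measure \<Rightarrow> (('a \<Rightarrow> real) \<Rightarrow> ennreal) \<Rightarrow> ('a \<Rightarrow> real) \<Rightarrow> ('a \<Rightarrow> real) set" where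
  "subdiff M E u =
     (if E u < \<infinity> then
        {\<xi> \<in> L2 M. \<forall>z\<in>L2 M.
           enn2ereal (E z) - enn2ereal (E u) \<ge> ereal (LINT x|M. \<xi> x * (z x - u x))}
      else {})"

definition subdiff_dom :: "'a measure \<Rightarrow> (('a \<Rightarrow> real) \<Rightarrow> ennreal) \<Rightarrow> ('a \<Rightarrow> real) set" where
  "subdiff_dom M E = {u \<in> L2 M. subdiff M E u \<noteq> {}}"

definition subdiff_one_homogeneous :: "'a measure \<Rightarrow> (('a \<Rightarrow> real) \<Rightarrow> ennreal) \<Rightarrow> bool" where
  "subdiff_one_homogeneous M E \<longleftrightarrow>
     (\<forall>u\<in>L2 M. \<forall>\<nu>::real. \<nu> \<noteq> 0 \<longrightarrow>
        subdiff M E (\<lambda>x. \<nu> * u x) = (\<lambda>\<xi> x. \<nu> * \<xi> x) ` subdiff M E u)"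

end

theory Submission
  imports Defs
begin

text \<open>
  If \<open>E\<close> is 2-homogeneous, rescaling the test functions in the subgradient inequality shows that
  multiplication by \<open>\<nu>\<close> carries subgradients at \<open>u\<close> to subgradients at \<open>\<nu> u\<close>
  (\<open>subdiff_scale\<close>). Along the line through \<open>u\<close>, \<open>E\<close> is the parabola \<open>s \<mapsto> s\<^sup>2 E u\<close>, whose slope at
  \<open>s = 1\<close> must be the pairing of \<open>u\<close> with the subgradient; this is the identity
  \<open>\<integral> u \<xi> = 2 E u\<close> (\<open>subgradient_pairing\<close>).

  Conversely, let the subdifferential be 1-homogeneous and \<open>E 0 = 0\<close>. If \<open>\<xi>\<close> is a subgradient at
  \<open>u\<close>, then \<open>t \<xi>\<close> is one at \<open>t u\<close>, so \<open>t \<mapsto> E (t u)\<close> has the derivative \<open>t \<integral> u \<xi>\<close> and vanishes at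
  0. It is therefore quadratic, which gives 2-homogeneity on the domain of the subdifferential
  (\<open>homogeneous_on_subdiff_dom\<close>).

  The remaining points \<open>u\<close> of finite energy are reached by the proximal (Moreau--Yosida) approximation:
  the minimizer \<open>w\<close> of \<open>E v + \<kappa> \<parallel>u - v\<parallel>\<^sup>2\<close> exists because \<open>L\<^sup>2\<close> is complete, has the subgradient
  \<open>2 \<kappa> (u - w)\<close>, satisfies \<open>E w \<le> E u\<close> and tends to \<open>u\<close> as \<open>\<kappa> \<rightarrow> \<infinity>\<close>
  (\<open>subdiff_dom_approximation\<close>). Since \<open>E (\<nu> w) = \<nu>\<^sup>2 E w \<le> \<nu>\<^sup>2 E u\<close>, lower semicontinuity yields
  \<open>E (\<nu> u) \<le> \<nu>\<^sup>2 E u\<close> (\<open>homogeneous_upper_bound\<close>), and the same bound at \<open>\<nu> u\<close> with the factor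
  \<open>1 / \<nu>\<close> is the reverse inequality. It also shows that infinite energy is preserved by nonzero factors.
\<close>

section \<open>Square-integrable functions\<close>

lemma L2_D:
  assumes "u \<in> L2 M"
  shows "u \<in> borel_measurable M" "integrable M (\<lambda>x. (u x)\<^sup>2)"
  using assms by (auto simp: L2_def)

lemma L2_zero: "(\<lambda>x. 0) \<in> L2 M"
  by (auto simp: L2_def)

lemma L2_scale:
  assumes "u \<in> L2 M"
  shows "(\<lambda>x. c * u x) \<in> L2 M"
  using L2_D[OF assms] by (auto simp: L2_def power_mult_distrib)

lemma L2_mult_integrable:
  assumes "u \<in> L2 M" "v \<in> L2 M"
  shows "integrable M (\<lambda>x. u x * v x)"
proof (rule Bochner_Integration.integrable_bound)
  show "integrable M (\<lambda>x. (u x)\<^sup>2 + (v x)\<^sup>2)"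
    using L2_D[OF assms(1)] L2_D[OF assms(2)] by auto
  show "(\<lambda>x. u x * v x) \<in> borel_measurable M"
    using L2_D[OF assms(1)] L2_D[OF assms(2)] by auto
  have "\<bar>a * b\<bar> \<le> \<bar>a\<^sup>2 + b\<^sup>2\<bar>" for a b :: real
  proof -
    have "0 \<le> (\<bar>a\<bar> - \<bar>b\<bar>)\<^sup>2" "0 \<le> \<bar>a\<bar> * \<bar>b\<bar>" by auto
    then have "2 * (\<bar>a\<bar> * \<bar>b\<bar>) \<le> a\<^sup>2 + b\<^sup>2" by (simp add: power2_diff)
    with \<open>0 \<le> \<bar>a\<bar> * \<bar>b\<bar>\<close> show ?thesis unfolding abs_mult by linarith
  qed
  then show "AE x in M. norm (u x * v x) \<le> norm ((u x)\<^sup>2 + (v x)\<^sup>2)"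
    by simp
qed

lemma L2_add:
  assumes "u \<in> L2 M" "v \<in> L2 M"
  shows "(\<lambda>x. u x + v x) \<in> L2 M"
  using L2_D[OF assms(1)] L2_D[OF assms(2)] L2_mult_integrable[OF assms]
  by (auto simp: L2_def power2_sum mult.assoc)

lemma L2_diff:
  assumes "u \<in> L2 M" "v \<in> L2 M"
  shows "(\<lambda>x. u x - v x) \<in> L2 M"
  using L2_add[OF assms(1) L2_scale[OF assms(2), of "-1"]] by simp

lemma L2_diff_sq_integrable:
  assumes "u \<in> L2 M" "v \<in> L2 M"
  shows "integrable M (\<lambda>x. (u x - v x)\<^sup>2)"
  using L2_D(2)[OF L2_diff[OF assms]] .

text \<open>
  This is the Riesz--Fischer theorem for geometrically Cauchy sequences; every Cauchy sequence has
  such a subsequence. As \<open>2\<bar>d\<bar> \<le> 2\<^sup>-\<^sup>n + 2\<^sup>n d\<^sup>2\<close>, the geometric bound on the squared increments makes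
  the increments absolutely summable almost everywhere, so that a pointwise limit exists, and
  Fatou's lemma carries the bound over to this limit.
\<close>

lemma L2_geometric_Cauchy_limit:
  fixes v :: "nat \<Rightarrow> 'a \<Rightarrow> real"
  assumes v: "\<And>n. v n \<in> L2 M"
    and cauchy: "\<And>m n. n \<le> m \<Longrightarrow> (LINT x|M. (v m x - v n x)\<^sup>2) \<le> C / 4 ^ n"
  shows "\<exists>w\<in>L2 M. \<forall>n. (LINT x|M. (w x - v n x)\<^sup>2) \<le> C / 4 ^ n"
proof -
  have meas [measurable]: "v n \<in> borel_measurable M" for n
    using L2_D(1)[OF v] .
  have int: "integrable M (\<lambda>x. (v m x - v n x)\<^sup>2)" for m n
    by (rule L2_diff_sq_integrable[OF v v])
  have nn: "(\<integral>\<^sup>+ x. ennreal ((v m x - v n x)\<^sup>2) \<partial>M) \<le> ennreal (C / 4 ^ n)" if "n \<le> m" for m n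
    using nn_integral_eq_integral[OF int[of m n]] cauchy[OF that] by (simp add: ennreal_leI)
  have C: "0 \<le> C"
    using cauchy[of 0 0] by simp
  define d where "d n x = v (Suc n) x - v n x" for n x
  have [measurable]: "d n \<in> borel_measurable M" for n
    unfolding d_def by measurable
  have "(\<integral>\<^sup>+ x. (\<Sum>n. ennreal (2 ^ n * (d n x)\<^sup>2)) \<partial>M)
      = (\<Sum>n. \<integral>\<^sup>+ x. ennreal (2 ^ n * (d n x)\<^sup>2) \<partial>M)"
    by (intro nn_integral_suminf) auto
  also have "\<dots> \<le> (\<Sum>n. ennreal (C * (1/2) ^ n))"
  proof (intro suminf_le summableI)
    fix n
    have "(\<integral>\<^sup>+ x. ennreal (2 ^ n * (d n x)\<^sup>2) \<partial>M) = ennreal (2 ^ n) * (\<integral>\<^sup>+ x. ennreal ((d n x)\<^sup>2) \<partial>M)"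
      by (subst nn_integral_cmult[symmetric]) (auto simp: ennreal_mult)
    also have "\<dots> \<le> ennreal (2 ^ n) * ennreal (C / 4 ^ n)"
      unfolding d_def by (intro mult_left_mono nn) auto
    also have "\<dots> = ennreal (C * (1/2) ^ n)"
    proof -
      have "(2::real) ^ n * (C / 4 ^ n) = C * (1/2) ^ n"
        by (simp add: power_divide field_simps flip: power_mult_distrib)
      then show ?thesis
        using C by (simp flip: ennreal_mult)
    qed
    finally show "(\<integral>\<^sup>+ x. ennreal (2 ^ n * (d n x)\<^sup>2) \<partial>M) \<le> ennreal (C * (1/2) ^ n)" .
  qed
  also have "\<dots> < \<infinity>"
  proof -
    have "summable (\<lambda>n. C * (1/2::real) ^ n)"
      by (intro summable_mult summable_geometric) simp
    then show ?thesis
      using C by (simp add: suminf_ennreal2 less_top)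
  qed
  finally have "AE x in M. (\<Sum>n. ennreal (2 ^ n * (d n x)\<^sup>2)) \<noteq> \<infinity>"
    by (intro nn_integral_PInf_AE) auto
  then have conv: "AE x in M. convergent (\<lambda>n. v n x)"
  proof eventually_elim
    case (elim x)
    have "summable (\<lambda>n. 2 ^ n * (d n x)\<^sup>2)"
      by (rule summable_suminf_not_top) (use elim in auto)
    then have "summable (\<lambda>n. (1/2) ^ n + 2 ^ n * (d n x)\<^sup>2)"
      by (intro summable_add summable_geometric) simp_all
    then have "summable (\<lambda>n. d n x)"
    proof (rule summable_comparison_test')
      fix n :: nat
      define a :: real where "a = 2 ^ n"
      have a: "a > 0" by (simp add: a_def)
      have "0 \<le> (a * \<bar>d n x\<bar> - 1)\<^sup>2" "0 \<le> a * \<bar>d n x\<bar>" using a by simp_all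
      then have "a * \<bar>d n x\<bar> \<le> 1 + a * (a * (d n x)\<^sup>2)"
        by (simp add: power2_diff power_mult_distrib power2_eq_square algebra_simps)
      then have "\<bar>d n x\<bar> \<le> 1 / a + a * (d n x)\<^sup>2"
        using a by (simp add: field_simps)
      then show "norm (d n x) \<le> (1/2) ^ n + 2 ^ n * (d n x)\<^sup>2"
        by (simp add: a_def power_divide)
    qed
    then have "convergent (\<lambda>n. \<Sum>i<n. d i x)"
      by (simp add: summable_iff_convergent)
    moreover have "(\<Sum>i<n. d i x) = v n x - v 0 x" for n
      unfolding d_def by (rule sum_lessThan_telescope)
    ultimately have "convergent (\<lambda>n. (v n x - v 0 x) + v 0 x)"
      by (intro convergent_add convergent_const) simp
    then show ?case by simp
  qed
  define w where "w x = lim (\<lambda>n. v n x)" for x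
  have w [measurable]: "w \<in> borel_measurable M"
    unfolding w_def by measurable
  have fatou: "(\<integral>\<^sup>+ x. ennreal ((w x - v n x)\<^sup>2) \<partial>M) \<le> ennreal (C / 4 ^ n)" for n
  proof -
    have "(\<integral>\<^sup>+ x. ennreal ((w x - v n x)\<^sup>2) \<partial>M)
        = (\<integral>\<^sup>+ x. liminf (\<lambda>m. ennreal ((v m x - v n x)\<^sup>2)) \<partial>M)"
    proof (rule nn_integral_cong_AE)
      show "AE x in M. ennreal ((w x - v n x)\<^sup>2) = liminf (\<lambda>m. ennreal ((v m x - v n x)\<^sup>2))"
        using conv
      proof eventually_elim
        case (elim x)
        then have "(\<lambda>m. v m x) \<longlonglongrightarrow> w x"
          by (simp add: w_def convergent_LIMSEQ_iff)
        then have "(\<lambda>m. ennreal ((v m x - v n x)\<^sup>2)) \<longlonglongrightarrow> ennreal ((w x - v n x)\<^sup>2)"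
          by (intro tendsto_ennrealI tendsto_intros)
        then show ?case
          by (intro lim_imp_Liminf[symmetric]) simp_all
      qed
    qed
    also have "\<dots> \<le> liminf (\<lambda>m. \<integral>\<^sup>+ x. ennreal ((v m x - v n x)\<^sup>2) \<partial>M)"
      by (rule nn_integral_liminf) auto
    also have "\<dots> \<le> liminf (\<lambda>m. ennreal (C / 4 ^ n))"
      by (intro Liminf_mono) (rule eventually_mono[OF eventually_ge_at_top[of n] nn])
    also have "\<dots> = ennreal (C / 4 ^ n)"
      by (simp add: Liminf_const)
    finally show ?thesis .
  qed
  have wv: "integrable M (\<lambda>x. (w x - v n x)\<^sup>2)" for n
  proof (rule integrableI_nonneg)
    show "(\<integral>\<^sup>+ x. ennreal ((w x - v n x)\<^sup>2) \<partial>M) < \<infinity>"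
      using fatou[of n] by (rule le_less_trans) simp
  qed auto
  have "(\<lambda>x. w x - v 0 x) \<in> L2 M"
    using wv[of 0] by (auto simp: L2_def)
  from L2_add[OF this v[of 0]] have "w \<in> L2 M"
    by simp
  moreover have "(LINT x|M. (w x - v n x)\<^sup>2) \<le> C / 4 ^ n" for n
  proof -
    have "ennreal (LINT x|M. (w x - v n x)\<^sup>2) \<le> ennreal (C / 4 ^ n)"
      using fatou[of n] nn_integral_eq_integral[OF wv[of n]] by simp
    then show ?thesis
      using C by simp
  qed
  ultimately show ?thesis by blast
qed

section \<open>Subgradients and convexity in terms of real energies\<close>

lemma mem_subdiff_iff:
  "\<xi> \<in> subdiff M E u \<longleftrightarrow> E u < \<infinity> \<and> \<xi> \<in> L2 M \<and>
     (\<forall>z\<in>L2 M. E z < \<infinity> \<longrightarrow> (LINT x|M. \<xi> x * (z x - u x)) \<le> enn2real (E z) - enn2real (E u))"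
proof (cases "E u < \<infinity>")
  case True
  then obtain a where a: "E u = ennreal a" "0 \<le> a"
    by (cases "E u") auto
  have "(ereal r \<le> enn2ereal (E z) - enn2ereal (E u)) \<longleftrightarrow>
      (E z < \<infinity> \<longrightarrow> r \<le> enn2real (E z) - enn2real (E u))" for z r
    using a by (cases "E z") (auto simp: enn2ereal_ennreal)
  with True show ?thesis
    by (simp add: subdiff_def)
next
  case False
  then show ?thesis by (simp add: subdiff_def)
qed

lemma L2_convex_real:
  assumes "L2_convex M E" "u \<in> L2 M" "v \<in> L2 M" "E u < \<infinity>" "E v < \<infinity>" "0 \<le> t" "t \<le> 1"
  shows "E (\<lambda>x. t * u x + (1 - t) * v x) < \<infinity>"
    and "enn2real (E (\<lambda>x. t * u x + (1 - t) * v x)) \<le> t * enn2real (E u) + (1 - t) * enn2real (E v)"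
proof -
  obtain a b where ab: "E u = ennreal a" "0 \<le> a" "E v = ennreal b" "0 \<le> b"
    using assms(4,5) by (cases "E u"; cases "E v") auto
  have "E (\<lambda>x. t * u x + (1 - t) * v x) \<le> ennreal t * E u + ennreal (1 - t) * E v"
    using assms unfolding L2_convex_def by auto
  also have "\<dots> = ennreal (t * a + (1 - t) * b)"
    using ab assms(6,7) by (simp add: ennreal_mult)
  finally have *: "E (\<lambda>x. t * u x + (1 - t) * v x) \<le> ennreal (t * a + (1 - t) * b)" .
  then show "E (\<lambda>x. t * u x + (1 - t) * v x) < \<infinity>"
    by (rule le_less_trans) simp
  show "enn2real (E (\<lambda>x. t * u x + (1 - t) * v x)) \<le> t * enn2real (E u) + (1 - t) * enn2real (E v)"
    using enn2real_leI[OF _ *] ab assms(6,7) by simp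
qed

section \<open>Homogeneous functionals have homogeneous subdifferentials\<close>

lemma subdiff_scale:
  assumes hom: "two_homogeneous M E" and u: "u \<in> L2 M" and \<xi>: "\<xi> \<in> subdiff M E u" and "\<nu> \<noteq> 0"
  shows "(\<lambda>x. \<nu> * \<xi> x) \<in> subdiff M E (\<lambda>x. \<nu> * u x)"
proof -
  have E: "E (\<lambda>x. c * f x) = ennreal (c\<^sup>2) * E f" if "f \<in> L2 M" for c f
    using hom that unfolding two_homogeneous_def by blast
  have fin: "E u < \<infinity>" and \<xi>L2: "\<xi> \<in> L2 M"
    and sub: "\<And>z. z \<in> L2 M \<Longrightarrow> E z < \<infinity> \<Longrightarrow>
      (LINT x|M. \<xi> x * (z x - u x)) \<le> enn2real (E z) - enn2real (E u)"
    using \<xi> by (auto simp: mem_subdiff_iff)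
  show ?thesis
    unfolding mem_subdiff_iff
  proof (intro conjI ballI impI)
    show "E (\<lambda>x. \<nu> * u x) < \<infinity>"
      using E[OF u] fin by (simp add: ennreal_mult_less_top)
    show "(\<lambda>x. \<nu> * \<xi> x) \<in> L2 M"
      by (rule L2_scale[OF \<xi>L2])
    fix z assume z: "z \<in> L2 M" "E z < \<infinity>"
    let ?y = "\<lambda>x. (1 / \<nu>) * z x"
    have y: "?y \<in> L2 M" by (rule L2_scale[OF z(1)])
    have Ey: "E ?y = ennreal ((1/\<nu>)\<^sup>2) * E z" by (rule E[OF z(1)])
    have "(LINT x|M. \<nu> * \<xi> x * (z x - \<nu> * u x)) = (LINT x|M. \<nu>\<^sup>2 * (\<xi> x * (?y x - u x)))"
      using \<open>\<nu> \<noteq> 0\<close> by (intro Bochner_Integration.integral_cong) (auto simp: field_simps power2_eq_square)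
    also have "\<dots> = \<nu>\<^sup>2 * (LINT x|M. \<xi> x * (?y x - u x))"
      by simp
    also have "\<dots> \<le> \<nu>\<^sup>2 * (enn2real (E ?y) - enn2real (E u))"
      using sub[OF y] Ey z(2) by (intro mult_left_mono) (auto simp: ennreal_mult_less_top)
    also have "\<dots> = enn2real (E z) - enn2real (E (\<lambda>x. \<nu> * u x))"
      using \<open>\<nu> \<noteq> 0\<close> unfolding Ey E[OF u]
      by (simp add: enn2real_mult algebra_simps power_divide)
    finally show "(LINT x|M. \<nu> * \<xi> x * (z x - \<nu> * u x))
        \<le> enn2real (E z) - enn2real (E (\<lambda>x. \<nu> * u x))" .
  qed
qed

text \<open>Equality follows from one inclusion for all scalars: apply it again with \<open>1 / \<nu>\<close>.\<close>

lemma two_homogeneous_imp_subdiff_one_homogeneous: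
  assumes hom: "two_homogeneous M E"
  shows "subdiff_one_homogeneous M E"
  unfolding subdiff_one_homogeneous_def
proof (intro ballI allI impI equalityI subsetI)
  fix u \<nu> \<xi>
  assume u: "u \<in> L2 M" and \<nu>: "\<nu> \<noteq> (0::real)"
  {
    assume "\<xi> \<in> (\<lambda>\<xi> x. \<nu> * \<xi> x) ` subdiff M E u"
    then show "\<xi> \<in> subdiff M E (\<lambda>x. \<nu> * u x)"
      using subdiff_scale[OF hom u _ \<nu>] by auto
  next
    assume "\<xi> \<in> subdiff M E (\<lambda>x. \<nu> * u x)"
    from subdiff_scale[OF hom L2_scale[OF u] this, of "1 / \<nu>"] \<nu>
    have "(\<lambda>x. (1 / \<nu>) * \<xi> x) \<in> subdiff M E u" by simp
    then show "\<xi> \<in> (\<lambda>\<xi> x. \<nu> * \<xi> x) ` subdiff M E u"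
      by (rule rev_image_eqI) (use \<nu> in simp)
  }
qed

lemma two_homogeneous_zero:
  assumes "two_homogeneous M E"
  shows "E (\<lambda>x. 0) = 0"
proof -
  have "\<forall>\<nu>. E (\<lambda>x. \<nu> * 0) = ennreal (\<nu>\<^sup>2) * E (\<lambda>x. 0)"
    using assms L2_zero[of M] unfolding two_homogeneous_def by (rule bspec)
  from spec[OF this, of 0] have "E (\<lambda>x. 0 * 0) = ennreal (0\<^sup>2) * E (\<lambda>x. 0)" .
  then show ?thesis by simp
qed

text \<open>Zero is a minimum point, so that the zero function is a subgradient there.\<close>

lemma zero_mem_subdiff_zero:
  assumes "E (\<lambda>x. 0) = 0"
  shows "(\<lambda>x. 0) \<in> subdiff M E (\<lambda>x. 0)"
  using assms by (simp add: mem_subdiff_iff L2_zero)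

lemma subdiff_dom_scale:
  assumes hom: "two_homogeneous M E" and u: "u \<in> subdiff_dom M E"
  shows "(\<lambda>x. \<nu> * u x) \<in> subdiff_dom M E"
proof (cases "\<nu> = 0")
  case True
  then show ?thesis
    using zero_mem_subdiff_zero[of E M] two_homogeneous_zero[OF hom] L2_zero[of M]
    by (auto simp: subdiff_dom_def)
next
  case False
  then show ?thesis
    using u subdiff_scale[OF hom _ _ False] L2_scale unfolding subdiff_dom_def by blast
qed

text \<open>
  Testing the subgradient inequality at \<open>u\<close> with \<open>s u\<close> gives \<open>(s\<^sup>2 - 1) E u \<ge> (s - 1) \<integral> \<xi> u\<close> for
  all real \<open>s\<close>, with equality at \<open>s = 1\<close>; there the derivatives of both sides agree.
\<close>

lemma subgradient_pairing:
  assumes hom: "two_homogeneous M E" and u: "u \<in> L2 M" and \<xi>: "\<xi> \<in> subdiff M E u"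
  shows "(LINT x|M. u x * \<xi> x) = 2 * enn2real (E u)"
proof -
  define e where "e = enn2real (E u)"
  define a where "a = (LINT x|M. u x * \<xi> x)"
  define d where "d = 2 * e - a"
  have e: "0 \<le> e" by (simp add: e_def)
  have ineq: "(s - 1) * a \<le> (s\<^sup>2 - 1) * e" for s
  proof -
    have Es: "E (\<lambda>x. s * u x) = ennreal (s\<^sup>2) * E u"
      using hom u unfolding two_homogeneous_def by blast
    have "E u < \<infinity>" using \<xi> by (simp add: mem_subdiff_iff)
    then have "E (\<lambda>x. s * u x) < \<infinity>" by (simp add: Es ennreal_mult_less_top)
    then have "(LINT x|M. \<xi> x * (s * u x - u x)) \<le> enn2real (E (\<lambda>x. s * u x)) - e"
      using \<xi> L2_scale[OF u, of s] by (simp add: mem_subdiff_iff e_def)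
    moreover have "(LINT x|M. \<xi> x * (s * u x - u x)) = (LINT x|M. (s - 1) * (u x * \<xi> x))"
      by (intro Bochner_Integration.integral_cong) (auto simp: algebra_simps)
    moreover have "\<dots> = (s - 1) * a"
      by (simp add: a_def)
    ultimately show ?thesis
      by (simp add: Es enn2real_mult e_def algebra_simps)
  qed
  \<comment> \<open>With \<open>h = s - 1\<close>, the inequality reads \<open>0 \<le> h (d + h e)\<close>; this choice of \<open>h\<close> turns the right side into minus a square.\<close>
  have "0 \<le> (- d / (e + 1)) * (d + (- d / (e + 1)) * e)"
    using ineq[of "1 + (- d / (e + 1))"]
    by (simp add: d_def power2_eq_square algebra_simps)
  also have "\<dots> = - ((d / (e + 1))\<^sup>2)"
    using e by (simp add: field_simps power2_eq_square)
  finally have "d = 0"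
    using e by simp
  then show ?thesis
    by (simp add: d_def a_def e_def)
qed

section \<open>Homogeneity on the domain of the subdifferential\<close>

text \<open>
  The hypothesis says that \<open>t a\<close> is a subgradient of \<open>\<phi>\<close> at \<open>t\<close>. Hence \<open>\<phi> t - a t\<^sup>2 / 2\<close>
  varies by at most \<open>a (s - t)\<^sup>2 / 2\<close> between \<open>s\<close> and \<open>t\<close>, and so has zero derivative.
\<close>

lemma linear_subgradient_imp_quadratic:
  fixes \<phi> :: "real \<Rightarrow> real"
  assumes sub: "\<And>s t. t * (s - t) * a \<le> \<phi> s - \<phi> t" and "\<phi> 0 = 0"
  shows "\<phi> t = a * t\<^sup>2 / 2"
proof -
  define g where "g t = \<phi> t - a * t\<^sup>2 / 2" for t
  have lower: "- (a * (s - t)\<^sup>2 / 2) \<le> g s - g t" for s t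
    using sub[of t s] by (simp add: g_def power2_eq_square field_simps)
  have bound: "\<bar>g s - g t\<bar> \<le> a * (s - t)\<^sup>2 / 2" for s t
    using lower[of s t] lower[of t s] unfolding power2_commute[of t s] by linarith
  have "(g has_real_derivative 0) (at t)" for t
    unfolding has_field_derivative_iff
  proof (rule Lim_null_comparison)
    show "((\<lambda>s. a * \<bar>s - t\<bar> / 2) \<longlongrightarrow> 0) (at t)"
      by (auto intro!: tendsto_eq_intros)
    show "\<forall>\<^sub>F s in at t. norm ((g s - g t) / (s - t)) \<le> a * \<bar>s - t\<bar> / 2"
      unfolding eventually_at_filter
    proof (intro always_eventually allI impI)
      fix s assume "s \<noteq> t"
      then have "0 < \<bar>s - t\<bar>" by simp
      moreover have "\<bar>g s - g t\<bar> \<le> (a * \<bar>s - t\<bar> / 2) * \<bar>s - t\<bar>"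
        using bound[of s t] by (simp add: power2_eq_square)
      ultimately show "norm ((g s - g t) / (s - t)) \<le> a * \<bar>s - t\<bar> / 2"
        by (simp add: abs_divide pos_divide_le_eq)
    qed
  qed
  then have "g t = g 0"
    by (intro DERIV_isconst_all) blast
  then show ?thesis
    using \<open>\<phi> 0 = 0\<close> by (simp add: g_def)
qed

text \<open>
  For \<open>t = 0\<close>, where homogeneity of the subdifferential says nothing, \<open>0\<close> is a subgradient at \<open>0\<close>
  by the normalization of \<open>E\<close>.
\<close>

lemma homogeneous_on_subdiff_dom:
  assumes hom: "subdiff_one_homogeneous M E" and E0: "E (\<lambda>x. 0) = 0"
    and u: "u \<in> subdiff_dom M E"
  shows "E (\<lambda>x. \<nu> * u x) = ennreal (\<nu>\<^sup>2) * E u"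
proof -
  from u obtain \<xi> where uL2: "u \<in> L2 M" and \<xi>: "\<xi> \<in> subdiff M E u"
    by (auto simp: subdiff_dom_def)
  have \<xi>t: "(\<lambda>x. t * \<xi> x) \<in> subdiff M E (\<lambda>x. t * u x)" for t
  proof (cases "t = 0")
    case True
    then show ?thesis using zero_mem_subdiff_zero[of E M] E0 by simp
  next
    case False
    then have "subdiff M E (\<lambda>x. t * u x) = (\<lambda>\<xi> x. t * \<xi> x) ` subdiff M E u"
      using hom uL2 unfolding subdiff_one_homogeneous_def by blast
    then show ?thesis using \<xi> by auto
  qed
  have fin: "E (\<lambda>x. t * u x) < \<infinity>" for t
    using \<xi>t[of t] by (simp add: mem_subdiff_iff)
  define \<phi> where "\<phi> t = enn2real (E (\<lambda>x. t * u x))" for t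
  define a where "a = (LINT x|M. \<xi> x * u x)"
  have "t * (s - t) * a \<le> \<phi> s - \<phi> t" for s t
  proof -
    have "t * (s - t) * a = (LINT x|M. t * (s - t) * (\<xi> x * u x))"
      by (simp add: a_def)
    also have "\<dots> = (LINT x|M. t * \<xi> x * (s * u x - t * u x))"
      by (intro Bochner_Integration.integral_cong) (auto simp: algebra_simps)
    also have "\<dots> \<le> \<phi> s - \<phi> t"
      using \<xi>t[of t] fin[of s] L2_scale[OF uL2, of s] unfolding \<phi>_def mem_subdiff_iff by blast
    finally show ?thesis .
  qed
  then have quad: "\<phi> t = a * t\<^sup>2 / 2" for t
    by (rule linear_subgradient_imp_quadratic) (simp add: \<phi>_def E0)
  have "\<phi> \<nu> = \<nu>\<^sup>2 * \<phi> 1"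
    by (simp add: quad)
  then have "ennreal (\<phi> \<nu>) = ennreal (\<nu>\<^sup>2) * ennreal (\<phi> 1)"
    by (simp add: ennreal_mult \<phi>_def)
  then show ?thesis
    using fin[of \<nu>] fin[of 1] by (simp add: \<phi>_def)
qed

section \<open>Proximal points\<close>

text \<open>
  Evaluating \<open>E\<close> with \<^const>\<open>enn2real\<close> keeps the arithmetic in the reals, but assigns the energy 0
  to points where \<open>E\<close> is infinite; minimization therefore has to be restricted to
  competitors of finite energy.
\<close>

definition prox_energy ::
  "'a measure \<Rightarrow> (('a \<Rightarrow> real) \<Rightarrow> ennreal) \<Rightarrow> real \<Rightarrow> ('a \<Rightarrow> real) \<Rightarrow> ('a \<Rightarrow> real) \<Rightarrow> real" where
  "prox_energy M E \<kappa> u v = enn2real (E v) + \<kappa> * (LINT x|M. (u x - v x)\<^sup>2)"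

text \<open>
  By the parallelogram identity, the midpoint of two almost minimizers would beat both of them
  unless they were close to each other; so a minimizing sequence is Cauchy. Lower
  semicontinuity makes its limit a minimizer.
\<close>

lemma prox_energy_minimizer:
  assumes conv: "L2_convex M E" and lsc: "L2_lsc M E"
    and u: "u \<in> L2 M" and Eu: "E u < \<infinity>" and \<kappa>: "0 < \<kappa>"
  obtains w where "w \<in> L2 M" "E w < \<infinity>"
    "\<And>v. v \<in> L2 M \<Longrightarrow> E v < \<infinity> \<Longrightarrow> prox_energy M E \<kappa> u w \<le> prox_energy M E \<kappa> u v"
proof -
  define D where "D = {v \<in> L2 M. E v < \<infinity>}"
  let ?F = "prox_energy M E \<kappa> u"
  define I where "I = Inf (?F ` D)"
  have F_nonneg: "0 \<le> ?F v" for v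
    using \<kappa> by (simp add: prox_energy_def)
  have bdd: "bdd_below (?F ` D)"
    using F_nonneg by (intro bdd_belowI[of _ 0]) auto
  have ne: "?F ` D \<noteq> {}"
    using u Eu by (auto simp: D_def)
  have I_le: "I \<le> ?F v" if "v \<in> D" for v
    unfolding I_def by (rule cInf_lower) (use bdd that in auto)
  have "\<exists>v\<in>D. ?F v < I + 1 / 4 ^ n" for n :: nat
    using cInf_lessD[OF ne, of "I + 1 / 4 ^ n"] unfolding I_def by auto
  then obtain v where vD: "\<And>n. v n \<in> D" and Fv: "\<And>n. ?F (v n) < I + 1 / 4 ^ n"
    by metis
  have vL2: "v n \<in> L2 M" and Ev: "E (v n) < \<infinity>" for n
    using vD[of n] by (auto simp: D_def)
  have "(LINT x|M. (v m x - v n x)\<^sup>2) \<le> (4 / \<kappa>) / 4 ^ n" if "n \<le> m" for m n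
  proof -
    let ?mid = "\<lambda>x. (1/2) * v m x + (1 - 1/2) * v n x"
    have mid: "?mid \<in> L2 M"
      by (intro L2_add L2_scale vL2)
    have Emid: "E ?mid < \<infinity>"
        "enn2real (E ?mid) \<le> (1/2) * enn2real (E (v m)) + (1 - 1/2) * enn2real (E (v n))"
      using L2_convex_real[of M E "v m" "v n" "1/2"] conv vL2 Ev by simp_all
    have "(LINT x|M. (u x - ?mid x)\<^sup>2) = (LINT x|M. (1/2) * (u x - v m x)\<^sup>2
        + (1/2) * (u x - v n x)\<^sup>2 - (1/4) * (v m x - v n x)\<^sup>2)"
      by (intro Bochner_Integration.integral_cong) (auto simp: power2_eq_square field_simps)
    also have "\<dots> = (1/2) * (LINT x|M. (u x - v m x)\<^sup>2) + (1/2) * (LINT x|M. (u x - v n x)\<^sup>2)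
        - (1/4) * (LINT x|M. (v m x - v n x)\<^sup>2)"
      using L2_diff_sq_integrable[OF u vL2] L2_diff_sq_integrable[OF vL2 vL2] by simp
    finally have par: "\<kappa> * (LINT x|M. (u x - ?mid x)\<^sup>2) = (1/2) * (\<kappa> * (LINT x|M. (u x - v m x)\<^sup>2))
        + (1/2) * (\<kappa> * (LINT x|M. (u x - v n x)\<^sup>2)) - (1/4) * (\<kappa> * (LINT x|M. (v m x - v n x)\<^sup>2))"
      by (simp only: distrib_left right_diff_distrib mult.left_commute[of \<kappa>])
    have "I \<le> ?F ?mid"
      using I_le mid Emid(1) by (auto simp: D_def)
    also have "\<dots> \<le> (1/2) * ?F (v m) + (1/2) * ?F (v n) - (1/4) * (\<kappa> * (LINT x|M. (v m x - v n x)\<^sup>2))"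
      unfolding prox_energy_def par using Emid(2) by (simp add: algebra_simps)
    finally have "\<kappa> * (LINT x|M. (v m x - v n x)\<^sup>2) \<le> 2 * (1 / 4 ^ m) + 2 * (1 / 4 ^ n)"
      using Fv[of m] Fv[of n] by linarith
    also have "1 / 4 ^ m \<le> 1 / (4::real) ^ n"
      using that by (intro divide_left_mono power_increasing) auto
    finally have "\<kappa> * (LINT x|M. (v m x - v n x)\<^sup>2) \<le> 4 / 4 ^ n"
      by simp
    then show ?thesis
      using \<kappa> by (simp add: field_simps)
  qed
  then obtain w where w: "w \<in> L2 M"
    and vw: "\<And>n. (LINT x|M. (w x - v n x)\<^sup>2) \<le> (4 / \<kappa>) / 4 ^ n"
    using L2_geometric_Cauchy_limit[of v M "4 / \<kappa>"] vL2 by blast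
  define Q where "Q = (LINT x|M. (u x - w x)\<^sup>2)"
  \<comment> \<open>The weights \<open>2\<^sup>-\<^sup>n\<close> and \<open>2\<^sup>n\<close> in the estimate of the mixed term balance the rate \<open>4\<^sup>-\<^sup>n\<close>.\<close>
  have Q_le: "Q - (1/2) ^ n * (Q + 4 / \<kappa>) \<le> (LINT x|M. (u x - v n x)\<^sup>2)" for n
  proof -
    define b :: real where "b = 2 ^ n"
    have b: "0 < b" by (simp add: b_def)
    have bb: "4 ^ n = b * b" by (simp add: b_def flip: power_mult_distrib)
    have pointwise: "(1 - 1/b) * p\<^sup>2 - b * r\<^sup>2 \<le> (p + r)\<^sup>2" for p r :: real
    proof -
      have "0 \<le> (p + b * r)\<^sup>2 / b + r\<^sup>2" using b by simp
      also have "\<dots> = (p + r)\<^sup>2 - ((1 - 1/b) * p\<^sup>2 - b * r\<^sup>2)"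
        using b by (simp add: power2_eq_square field_simps)
      finally show ?thesis by simp
    qed
    have "(1 - 1/b) * Q - b * ((4 / \<kappa>) / 4 ^ n) \<le> (1 - 1/b) * Q - b * (LINT x|M. (w x - v n x)\<^sup>2)"
      using mult_left_mono[OF vw[of n], of b] b by linarith
    also have "\<dots> = (LINT x|M. (1 - 1/b) * (u x - w x)\<^sup>2 - b * (w x - v n x)\<^sup>2)"
      using L2_diff_sq_integrable[OF u w] L2_diff_sq_integrable[OF w vL2[of n]] by (simp add: Q_def)
    also have "\<dots> \<le> (LINT x|M. (u x - v n x)\<^sup>2)"
    proof (rule integral_mono)
      show "(1 - 1/b) * (u x - w x)\<^sup>2 - b * (w x - v n x)\<^sup>2 \<le> (u x - v n x)\<^sup>2" for x
        using pointwise[of "u x - w x" "w x - v n x"] by simp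
    qed (use L2_diff_sq_integrable[OF u w] L2_diff_sq_integrable[OF w vL2[of n]]
          L2_diff_sq_integrable[OF u vL2[of n]] in auto)
    finally have main: "(1 - 1/b) * Q - b * ((4 / \<kappa>) / 4 ^ n) \<le> (LINT x|M. (u x - v n x)\<^sup>2)" .
    have "b * ((4 / \<kappa>) / 4 ^ n) = (1/b) * (4/\<kappa>)"
      using b by (simp add: bb)
    moreover have "(1/2::real) ^ n = 1 / b"
      by (simp add: b_def power_divide)
    ultimately show ?thesis
      using main by (simp add: algebra_simps)
  qed
  define k where "k n = I + (1/4) ^ n - \<kappa> * (Q - (1/2) ^ n * (Q + 4 / \<kappa>))" for n :: nat
  have k: "enn2real (E (v n)) \<le> k n" for n
  proof -
    have "\<kappa> * (Q - (1/2) ^ n * (Q + 4 / \<kappa>)) \<le> \<kappa> * (LINT x|M. (u x - v n x)\<^sup>2)"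
      using Q_le[of n] \<kappa> by (intro mult_left_mono) auto
    moreover have "(1/4::real) ^ n = 1 / 4 ^ n"
      by (simp add: power_divide)
    ultimately show ?thesis
      using Fv[of n] unfolding k_def prox_energy_def by linarith
  qed
  have "k \<longlonglongrightarrow> I + 0 - \<kappa> * (Q - 0 * (Q + 4 / \<kappa>))"
    unfolding k_def by (intro tendsto_intros LIMSEQ_power_zero) auto
  then have lim_k: "k \<longlonglongrightarrow> I - \<kappa> * Q" by simp
  have K0: "0 \<le> I - \<kappa> * Q"
    by (rule LIMSEQ_le_const[OF lim_k]) (use order_trans[OF enn2real_nonneg k] in auto)
  have Ew: "E w \<le> ennreal (I - \<kappa> * Q)"
  proof (rule ccontr)
    assume "\<not> E w \<le> ennreal (I - \<kappa> * Q)"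
    then obtain c where c: "ennreal (I - \<kappa> * Q) < c" "c < E w"
      unfolding not_le by (blast dest: dense)
    then obtain r where r: "c = ennreal r" "0 \<le> r"
      using c(2) by (cases c) auto
    have Kr: "I - \<kappa> * Q < r"
      using c(1) r K0 by (simp add: ennreal_less_iff)
    obtain \<delta> where \<delta>: "0 < \<delta>"
      and near: "\<And>z. z \<in> L2 M \<Longrightarrow> L2_norm M (\<lambda>x. z x - w x) < \<delta> \<Longrightarrow> c < E z"
      using lsc w c(2) unfolding L2_lsc_def by blast
    have "\<forall>\<^sub>F n in sequentially. (4 / \<kappa>) * (1/4) ^ n < \<delta>\<^sup>2"
    proof (rule order_tendstoD)
      show "(\<lambda>n. (4 / \<kappa>) * (1/4) ^ n) \<longlonglongrightarrow> 0"
        by (intro tendsto_mult_right_zero LIMSEQ_power_zero) simp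
      show "0 < \<delta>\<^sup>2" using \<delta> by simp
    qed
    moreover have "\<forall>\<^sub>F n in sequentially. k n < r"
      using lim_k Kr by (rule order_tendstoD)
    ultimately have "\<forall>\<^sub>F n in sequentially. (4 / \<kappa>) * (1/4) ^ n < \<delta>\<^sup>2 \<and> k n < r"
      by eventually_elim simp
    then obtain n where n: "(4 / \<kappa>) * (1/4) ^ n < \<delta>\<^sup>2" "k n < r"
      by (auto simp: eventually_sequentially)
    have "(LINT x|M. (v n x - w x)\<^sup>2) < \<delta>\<^sup>2"
      using vw[of n] n(1) by (simp add: power2_commute power_divide)
    then have "L2_norm M (\<lambda>x. v n x - w x) < \<delta>"
      unfolding L2_norm_def using \<delta> by (intro real_less_lsqrt) auto
    then have "c < E (v n)"
      using near vL2 by blast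
    moreover have "E (v n) \<le> c"
    proof -
      have "E (v n) = ennreal (enn2real (E (v n)))"
        using Ev[of n] by simp
      also have "\<dots> \<le> ennreal r"
        using k[of n] n(2) by (intro ennreal_leI) simp
      finally show ?thesis by (simp add: r)
    qed
    ultimately show False by simp
  qed
  have "?F w \<le> I"
    using enn2real_leI[OF K0 Ew] by (simp add: prox_energy_def Q_def)
  moreover have "E w < \<infinity>"
    using Ew by (rule le_less_trans) simp
  ultimately show ?thesis
    using that[of w] w I_le unfolding D_def by (auto intro: order_trans)
qed

text \<open>
  This is the Euler--Lagrange inclusion for the proximal point \<open>w\<close> of \<open>u\<close>: in \<open>w + t (z - w)\<close>, the
  convexity bound is linear in \<open>t\<close>, and the quadratic term disappears upon dividing by \<open>t\<close> and
  letting \<open>t \<rightarrow> 0\<close>.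
\<close>

lemma prox_energy_minimizer_subdiff:
  assumes conv: "L2_convex M E" and u: "u \<in> L2 M" and w: "w \<in> L2 M" and Ew: "E w < \<infinity>"
    and min: "\<And>v. v \<in> L2 M \<Longrightarrow> E v < \<infinity> \<Longrightarrow> prox_energy M E \<kappa> u w \<le> prox_energy M E \<kappa> u v"
  shows "(\<lambda>x. 2 * \<kappa> * (u x - w x)) \<in> subdiff M E w"
  unfolding mem_subdiff_iff
proof (intro conjI ballI impI)
  show "E w < \<infinity>" by (rule Ew)
  show "(\<lambda>x. 2 * \<kappa> * (u x - w x)) \<in> L2 M"
    by (intro L2_scale L2_diff u w)
  fix z assume z: "z \<in> L2 M" and Ez: "E z < \<infinity>"
  define p where "p = (LINT x|M. (u x - w x) * (z x - w x))"
  define r where "r = (LINT x|M. (z x - w x)\<^sup>2)"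
  let ?e = "\<lambda>v. enn2real (E v)"
  have ineq: "2 * \<kappa> * p - t * (\<kappa> * r) \<le> ?e z - ?e w" if t: "0 < t" "t \<le> 1" for t
  proof -
    let ?v = "\<lambda>x. t * z x + (1 - t) * w x"
    have v: "?v \<in> L2 M" by (intro L2_add L2_scale z w)
    have Ev: "E ?v < \<infinity>" "?e ?v \<le> t * ?e z + (1 - t) * ?e w"
      using L2_convex_real[of M E z w t] conv z w Ez Ew t by auto
    have "(LINT x|M. (u x - ?v x)\<^sup>2) = (LINT x|M. (u x - w x)\<^sup>2
        - 2 * t * ((u x - w x) * (z x - w x)) + t\<^sup>2 * (z x - w x)\<^sup>2)"
      by (intro Bochner_Integration.integral_cong) (auto simp: power2_eq_square algebra_simps)
    also have "\<dots> = (LINT x|M. (u x - w x)\<^sup>2) - 2 * t * p + t\<^sup>2 * r"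
      using L2_diff_sq_integrable[OF u w] L2_diff_sq_integrable[OF z w]
        L2_mult_integrable[OF L2_diff[OF u w] L2_diff[OF z w]]
      by (simp add: p_def r_def)
    finally have sq: "\<kappa> * (LINT x|M. (u x - ?v x)\<^sup>2)
        = \<kappa> * (LINT x|M. (u x - w x)\<^sup>2) + \<kappa> * (- 2 * t * p + t\<^sup>2 * r)"
      by (simp only: flip: distrib_left) simp
    have "?e w \<le> t * ?e z + (1 - t) * ?e w + \<kappa> * (- 2 * t * p + t\<^sup>2 * r)"
      using min[OF v Ev(1)] Ev(2) unfolding prox_energy_def sq by linarith
    then have "t * (2 * \<kappa> * p - t * (\<kappa> * r)) \<le> t * (?e z - ?e w)"
      by (simp add: algebra_simps power2_eq_square)
    then show ?thesis using t by simp
  qed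
  have "((\<lambda>t. 2 * \<kappa> * p - t * (\<kappa> * r)) \<longlongrightarrow> 2 * \<kappa> * p - 0 * (\<kappa> * r)) (at_right 0)"
    by (intro tendsto_intros)
  moreover have "\<forall>\<^sub>F t in at_right 0. 2 * \<kappa> * p - t * (\<kappa> * r) \<le> ?e z - ?e w"
    using eventually_at_right_real[of 0 1] ineq by (auto elim!: eventually_mono)
  ultimately have "2 * \<kappa> * p - 0 * (\<kappa> * r) \<le> ?e z - ?e w"
    by (intro tendsto_upperbound) auto
  moreover have "(LINT x|M. 2 * \<kappa> * (u x - w x) * (z x - w x)) = 2 * \<kappa> * p"
    by (simp add: p_def mult.assoc)
  ultimately show "(LINT x|M. 2 * \<kappa> * (u x - w x) * (z x - w x)) \<le> ?e z - ?e w"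
    by simp
qed

text \<open>
  The competitor \<open>u\<close> in the proximal problem shows that the proximal point has no larger energy
  than \<open>u\<close>, and that it is close to \<open>u\<close> once \<open>\<kappa>\<close> is large.
\<close>

lemma subdiff_dom_approximation:
  assumes conv: "L2_convex M E" and lsc: "L2_lsc M E"
    and u: "u \<in> L2 M" and Eu: "E u < \<infinity>" and "0 < \<epsilon>"
  obtains w where "w \<in> subdiff_dom M E" "E w \<le> E u" "L2_norm M (\<lambda>x. w x - u x) < \<epsilon>"
proof -
  define \<kappa> where "\<kappa> = (enn2real (E u) + 1) / \<epsilon>\<^sup>2"
  have \<kappa>: "0 < \<kappa>"
    unfolding \<kappa>_def using \<open>0 < \<epsilon>\<close> by (intro divide_pos_pos add_nonneg_pos) auto
  obtain w where w: "w \<in> L2 M" "E w < \<infinity>"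
    and min: "\<And>v. v \<in> L2 M \<Longrightarrow> E v < \<infinity> \<Longrightarrow> prox_energy M E \<kappa> u w \<le> prox_energy M E \<kappa> u v"
    using prox_energy_minimizer[OF conv lsc u Eu \<kappa>] by blast
  have "w \<in> subdiff_dom M E"
    using prox_energy_minimizer_subdiff[OF conv u w min] w(1) by (auto simp: subdiff_dom_def)
  moreover have le: "enn2real (E w) + \<kappa> * (LINT x|M. (w x - u x)\<^sup>2) \<le> enn2real (E u)"
    using min[OF u Eu] by (simp add: prox_energy_def power2_commute)
  have "E w \<le> E u"
  proof -
    have "0 \<le> \<kappa> * (LINT x|M. (w x - u x)\<^sup>2)"
      using \<kappa> by simp
    then have "ennreal (enn2real (E w)) \<le> ennreal (enn2real (E u))"
      using le by (intro ennreal_leI) linarith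
    then show ?thesis using w(2) Eu by (simp only: ennreal_enn2real infinity_ennreal_def)
  qed
  moreover have "L2_norm M (\<lambda>x. w x - u x) < \<epsilon>"
  proof -
    have "\<kappa> * (LINT x|M. (w x - u x)\<^sup>2) < enn2real (E u) + 1"
      using le enn2real_nonneg[of "E w"] by linarith
    also have "\<dots> = \<kappa> * \<epsilon>\<^sup>2"
      using \<open>0 < \<epsilon>\<close> by (simp add: \<kappa>_def)
    finally have "(LINT x|M. (w x - u x)\<^sup>2) < \<epsilon>\<^sup>2"
      using \<kappa> by simp
    then show ?thesis
      unfolding L2_norm_def using \<open>0 < \<epsilon>\<close> by (intro real_less_lsqrt) auto
  qed
  ultimately show ?thesis using that by blast
qed

section \<open>Homogeneous subdifferentials come from homogeneous functionals\<close>

text \<open>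
  The bound holds at the approximants of \<open>u\<close> from the domain of the subdifferential, whose energy
  does not exceed that of \<open>u\<close>, and lower semicontinuity preserves upper bounds in the limit.
\<close>

lemma homogeneous_upper_bound:
  assumes conv: "L2_convex M E" and lsc: "L2_lsc M E"
    and hom: "subdiff_one_homogeneous M E" and E0: "E (\<lambda>x. 0) = 0"
    and u: "u \<in> L2 M" and "\<nu> \<noteq> 0"
  shows "E (\<lambda>x. \<nu> * u x) \<le> ennreal (\<nu>\<^sup>2) * E u"
proof (cases "E u < \<infinity>")
  case False
  then show ?thesis using \<open>\<nu> \<noteq> 0\<close> by (simp add: less_top[symmetric] ennreal_mult_top)
next
  case True
  show ?thesis
  proof (rule ccontr)
    assume "\<not> ?thesis"
    then have less: "ennreal (\<nu>\<^sup>2) * E u < E (\<lambda>x. \<nu> * u x)" by simp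
    obtain \<delta> where \<delta>: "0 < \<delta>" and near: "\<And>z. z \<in> L2 M \<Longrightarrow>
        L2_norm M (\<lambda>x. z x - \<nu> * u x) < \<delta> \<Longrightarrow> ennreal (\<nu>\<^sup>2) * E u < E z"
      using lsc L2_scale[OF u, of \<nu>] less unfolding L2_lsc_def by blast
    obtain w where w: "w \<in> subdiff_dom M E" "E w \<le> E u"
      and wu: "L2_norm M (\<lambda>x. w x - u x) < \<delta> / \<bar>\<nu>\<bar>"
      using subdiff_dom_approximation[OF conv lsc u True, of "\<delta> / \<bar>\<nu>\<bar>"] \<delta> \<open>\<nu> \<noteq> 0\<close> by auto
    have "(LINT x|M. (\<nu> * w x - \<nu> * u x)\<^sup>2) = \<nu>\<^sup>2 * (LINT x|M. (w x - u x)\<^sup>2)"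
      by (simp flip: right_diff_distrib add: power_mult_distrib)
    then have "L2_norm M (\<lambda>x. \<nu> * w x - \<nu> * u x) = \<bar>\<nu>\<bar> * L2_norm M (\<lambda>x. w x - u x)"
      by (simp add: L2_norm_def real_sqrt_mult)
    also have "\<dots> < \<delta>"
      using wu \<open>\<nu> \<noteq> 0\<close> by (simp add: field_simps)
    finally have "ennreal (\<nu>\<^sup>2) * E u < E (\<lambda>x. \<nu> * w x)"
      using near L2_scale w(1) unfolding subdiff_dom_def by blast
    also have "\<dots> = ennreal (\<nu>\<^sup>2) * E w"
      by (rule homogeneous_on_subdiff_dom[OF hom E0 w(1)])
    also have "\<dots> \<le> ennreal (\<nu>\<^sup>2) * E u"
      by (intro mult_left_mono w(2)) simp
    finally show False by simp
  qed
qed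

lemma subdiff_one_homogeneous_imp_two_homogeneous:
  assumes conv: "L2_convex M E" and lsc: "L2_lsc M E"
    and hom: "subdiff_one_homogeneous M E" and E0: "E (\<lambda>x. 0) = 0"
  shows "two_homogeneous M E"
  unfolding two_homogeneous_def
proof (intro ballI allI)
  fix u and \<nu> :: real
  assume u: "u \<in> L2 M"
  show "E (\<lambda>x. \<nu> * u x) = ennreal (\<nu>\<^sup>2) * E u"
  proof (cases "\<nu> = 0")
    case True
    then show ?thesis by (simp add: E0)
  next
    case False
    note bound = homogeneous_upper_bound[OF conv lsc hom E0]
    have "E u \<le> ennreal ((1/\<nu>)\<^sup>2) * E (\<lambda>x. \<nu> * u x)"
      using bound[OF L2_scale[OF u], of "1/\<nu>" \<nu>] False by simp
    then have "ennreal (\<nu>\<^sup>2) * E u \<le> ennreal (\<nu>\<^sup>2) * (ennreal ((1/\<nu>)\<^sup>2) * E (\<lambda>x. \<nu> * u x))"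
      by (rule mult_left_mono) simp
    also have "\<dots> = E (\<lambda>x. \<nu> * u x)"
      using False by (simp add: power_divide flip: mult.assoc ennreal_mult)
    finally show ?thesis
      using bound[OF u False] by (rule order_antisym[rotated])
  qed
qed

theorem theorem3p1:
  fixes M :: "'a measure" and E :: "('a \<Rightarrow> real) \<Rightarrow> ennreal"
  assumes "sigma_finite_measure M"
    and "bimeasurable_with_borel M"
    and "L2_functional M E"
    and "L2_convex M E"
    and "L2_lsc M E"
  shows "(two_homogeneous M E \<longrightarrow>
            E (\<lambda>x. 0) = 0 \<and>
            subdiff_one_homogeneous M E \<and>
            (\<forall>u\<in>subdiff_dom M E. \<forall>\<nu>::real. (\<lambda>x. \<nu> * u x) \<in> subdiff_dom M E) \<and>
            (\<forall>u\<in>subdiff_dom M E. \<forall>\<xi>\<in>subdiff M E u.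
               ereal (LINT x|M. u x * \<xi> x) = 2 * enn2ereal (E u))) \<and>
         (subdiff_one_homogeneous M E \<and> E (\<lambda>x. 0) = 0 \<longrightarrow> two_homogeneous M E)"
proof (intro conjI impI ballI allI)
  assume hom: "two_homogeneous M E"
  show "E (\<lambda>x. 0) = 0"
    by (rule two_homogeneous_zero[OF hom])
  show "subdiff_one_homogeneous M E"
    by (rule two_homogeneous_imp_subdiff_one_homogeneous[OF hom])
  show "(\<lambda>x. \<nu> * u x) \<in> subdiff_dom M E" if "u \<in> subdiff_dom M E" for u \<nu>
    by (rule subdiff_dom_scale[OF hom that])
  fix u \<xi> assume u: "u \<in> subdiff_dom M E" and \<xi>: "\<xi> \<in> subdiff M E u"
  have "E u < \<infinity>"
    using \<xi> by (simp add: mem_subdiff_iff)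
  then obtain e where e: "E u = ennreal e" "0 \<le> e"
    by (cases "E u") auto
  have "(LINT x|M. u x * \<xi> x) = 2 * e"
    using subgradient_pairing[OF hom _ \<xi>] u e by (simp add: subdiff_dom_def)
  then show "ereal (LINT x|M. u x * \<xi> x) = 2 * enn2ereal (E u)"
    using e by (simp add: enn2ereal_ennreal flip: times_ereal.simps(1))
next
  assume "subdiff_one_homogeneous M E \<and> E (\<lambda>x. 0) = 0"
  then show "two_homogeneous M E"
    using subdiff_one_homogeneous_imp_two_homogeneous assms(4,5) by blast
qed

end
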